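(* Let $\Gamma$ be a finite directed graph, possibly with loops and parallel edges, let $T:\Gamma\to\Gamma$ be a graph automorphism, and let $\lambda_0\in\mathbb{C}$ be an eigenvalue of $T$. There exists a polynomial $P_{T,\lambda_0}$ (in the variables $X_e=t^{\ell(e)}$, $e\in E(\Gamma)$, with complex coefficients, so that $P_{T,\lambda_0}(t,\ell)$ denotes its value at $X_e=t^{\ell(e)}$) such that for every $\ell\in V_T$ and every $0\neq\lambda\in\mathbb{C}$: $$P_{T,\lambda_0}(\lambda^{-1},\ell)=0\iff\lambda\in Z(\ell,\lambda_0).$$
   Context: For $\ell:E(\Gamma)\to\mathbb{N}$ (positive integers), $\Gamma_\ell$ is the directed graph obtained by subdividing each edge $e$ of $\Gamma$ into $\ell(e)$ edges, each inheriting the orientation of $e$, and $A_\ell$ is its adjacency matrix (the $(u,v)$ entry is the number of edges from $u$ to $v$), acting on column vectors in $W_\ell=\mathbb{C}^{V(\Gamma_\ell)}$. A graph automorphism of a directed graph is a pair of compatible bijections on vertices and edges, preserving orientation. $V_T$ is the set of all $\ell$ for which $T$ extends to a graph automorphism of $\Gamma_\ell$ (i.e. $\ell(T(e))=\ell(e)$ for every $e$). For $\ell\in V_T$, $T$ acts on $W_\ell$ by $(Tf)(v)=f(Tv)$, and this action commutes with $A_\ell$. "Eigenvalue of $T$" means eigenvalue of this action (for some $\ell\in V_T$). $Z(\ell,\lambda_0)$ is the set of all eigenvalues $\lambda$ of $A_\ell$ for which there is a nonzero $f\in W_\ell$ with $A_\ell f=\lambda f$ and $Tf=\lambda_0f$.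 *)

theory Defs
  imports Complex_Main "HOL-Library.Poly_Mapping" "Graph_Theory.Digraph_Isomorphism"
begin

(* The record of an isomorphism also carries the tail and head maps of the target graph; the
   equation below forces these two fields to be those of G, so only the vertex map and the arc
   map are free. *)
definition digraph_automorphism ::
  "('a, 'b) pre_digraph \<Rightarrow> ('a, 'b, 'a, 'b) digraph_isomorphism \<Rightarrow> bool" where
  "digraph_automorphism G T \<longleftrightarrow> pre_digraph.digraph_isomorphism G T \<and> app_iso T G = G"

lemma digraph_automorphism_iff:
  assumes "fin_digraph G"
  shows "digraph_automorphism G T \<longleftrightarrow>
    bij_betw (iso_verts T) (verts G) (verts G) \<and>
    bij_betw (iso_arcs T) (arcs G) (arcs G) \<and>
    (\<forall>e\<in>arcs G. tail G (iso_arcs T e) = iso_verts T (tail G e) \<and>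
                head G (iso_arcs T e) = iso_verts T (head G e)) \<and>
    iso_tail T = tail G \<and> iso_head T = head G"
proof -
  interpret fin_digraph G by fact
  have "app_iso T G = G \<longleftrightarrow> iso_verts T ` verts G = verts G \<and> iso_arcs T ` arcs G = arcs G \<and>
      iso_tail T = tail G \<and> iso_head T = head G"
    by (cases G) (simp add: app_iso_def)
  moreover have "wf_digraph G" by (rule wf_digraph)
  ultimately show ?thesis
    unfolding digraph_automorphism_def digraph_isomorphism_def bij_betw_def by metis
qed

(* Edge e is replaced by the path with arcs (e,0), ..., (e, l e - 1) and inner vertices
   Inr (e,1), ..., Inr (e, l e - 1); the arc (e,i) runs from the i-th to the (i+1)-st vertex
   of this path. *)
definition subdiv ::
  "('a, 'b) pre_digraph \<Rightarrow> ('b \<Rightarrow> nat) \<Rightarrow> ('a + 'b \<times> nat, 'b \<times> nat) pre_digraph" where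
  "subdiv G l = \<lparr>
     verts = Inl ` verts G \<union> {Inr (e, i) | e i. e \<in> arcs G \<and> 0 < i \<and> i < l e},
     arcs = {(e, i) | e i. e \<in> arcs G \<and> i < l e},
     tail = (\<lambda>(e, i). if i = 0 then Inl (tail G e) else Inr (e, i)),
     head = (\<lambda>(e, i). if Suc i = l e then Inl (head G e) else Inr (e, Suc i)) \<rparr>"

definition extend_iso ::
  "('a, 'b) pre_digraph \<Rightarrow> ('a, 'b, 'a, 'b) digraph_isomorphism \<Rightarrow> ('b \<Rightarrow> nat) \<Rightarrow>
   ('a + 'b \<times> nat, 'b \<times> nat, 'a + 'b \<times> nat, 'b \<times> nat) digraph_isomorphism" where
  "extend_iso G T l = \<lparr>
     iso_verts = (\<lambda>v. case v of Inl u \<Rightarrow> Inl (iso_verts T u) | Inr (e, i) \<Rightarrow> Inr (iso_arcs T e, i)),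
     iso_arcs = (\<lambda>(e, i). (iso_arcs T e, i)),
     iso_head = head (subdiv G l),
     iso_tail = tail (subdiv G l) \<rparr>"

(* The set V_T. Values of l outside arcs G are irrelevant. *)
definition invariant_lengths ::
  "('a, 'b) pre_digraph \<Rightarrow> ('a, 'b, 'a, 'b) digraph_isomorphism \<Rightarrow> ('b \<Rightarrow> nat) set" where
  "invariant_lengths G T = {l. \<forall>e\<in>arcs G. 0 < l e \<and> l (iso_arcs T e) = l e}"

lemma fin_digraph_subdiv:
  assumes "fin_digraph G" and "\<forall>e\<in>arcs G. 0 < l e"
  shows "fin_digraph (subdiv G l)"
proof -
  interpret fin_digraph G by fact
  have *: "{(e, i) | e i. e \<in> arcs G \<and> i < l e} = Sigma (arcs G) (\<lambda>e. {..<l e})" by auto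
  have fin: "finite {(e, i) | e i. e \<in> arcs G \<and> i < l e}" unfolding * by auto
  have "{Inr (e, i) | e i. e \<in> arcs G \<and> 0 < i \<and> i < l e}
      \<subseteq> (Inr ` {(e, i) | e i. e \<in> arcs G \<and> i < l e} :: ('a + 'b \<times> nat) set)" by auto
  then have "finite ({Inr (e, i) | e i. e \<in> arcs G \<and> 0 < i \<and> i < l e} :: ('a + 'b \<times> nat) set)"
    using fin by (meson finite_imageI finite_subset)
  then show ?thesis
    using fin by unfold_locales (auto simp: subdiv_def split: if_splits)
qed

lemma extend_iso_automorphism_iff:
  assumes G: "fin_digraph G" and T: "digraph_automorphism G T" and pos: "\<forall>e\<in>arcs G. 0 < l e"
  shows "digraph_automorphism (subdiv G l) (extend_iso G T l) \<longleftrightarrow> l \<in> invariant_lengths G T"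
proof -
  let ?S = "subdiv G l" and ?X = "extend_iso G T l"
  have T': "bij_betw (iso_verts T) (verts G) (verts G)" "bij_betw (iso_arcs T) (arcs G) (arcs G)"
    "\<And>e. e \<in> arcs G \<Longrightarrow> tail G (iso_arcs T e) = iso_verts T (tail G e)"
    "\<And>e. e \<in> arcs G \<Longrightarrow> head G (iso_arcs T e) = iso_verts T (head G e)"
    using T unfolding digraph_automorphism_iff[OF G] by blast+
  note iff = digraph_automorphism_iff[OF fin_digraph_subdiv[OF G pos], of ?X]
  show ?thesis
  proof
    assume "digraph_automorphism ?S ?X"
    then have hd: "\<And>a. a \<in> arcs ?S \<Longrightarrow> head ?S (iso_arcs ?X a) = iso_verts ?X (head ?S a)"
      unfolding iff by blast
    have "l (iso_arcs T e) = l e" if e: "e \<in> arcs G" for e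
      using hd[of "(e, l e - 1)"] e pos by (auto simp: subdiv_def extend_iso_def split: if_splits)
    then show "l \<in> invariant_lengths G T" using pos by (auto simp: invariant_lengths_def)
  next
    assume "l \<in> invariant_lengths G T"
    then have inv: "\<And>e. e \<in> arcs G \<Longrightarrow> l (iso_arcs T e) = l e"
      by (auto simp: invariant_lengths_def)
    have vG: "\<And>v. v \<in> verts G \<Longrightarrow> iso_verts T v \<in> verts G"
      and aG: "\<And>e. e \<in> arcs G \<Longrightarrow> iso_arcs T e \<in> arcs G"
      using T'(1,2) by (auto simp: bij_betw_def)
    have injv: "inj_on (iso_verts T) (verts G)" and inja: "inj_on (iso_arcs T) (arcs G)"
      using T'(1,2) by (simp_all add: bij_betw_def)
    have fin: "finite (verts ?S)" "finite (arcs ?S)"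
      using fin_digraph_subdiv[OF G pos]
      by (simp_all add: fin_digraph.finite_verts fin_digraph.finite_arcs)
    have "inj_on (iso_verts ?X) (verts ?S)"
      by (rule inj_onI)
        (auto simp: subdiv_def extend_iso_def dest: inj_onD[OF injv] inj_onD[OF inja])
    moreover have "iso_verts ?X ` verts ?S \<subseteq> verts ?S"
      by (auto simp: subdiv_def extend_iso_def vG aG inv)
    ultimately have 1: "bij_betw (iso_verts ?X) (verts ?S) (verts ?S)"
      using fin(1) by (simp add: bij_betw_def endo_inj_surj)
    have "inj_on (iso_arcs ?X) (arcs ?S)"
      by (rule inj_onI) (auto simp: subdiv_def extend_iso_def dest: inj_onD[OF inja])
    moreover have "iso_arcs ?X ` arcs ?S \<subseteq> arcs ?S"
      by (auto simp: subdiv_def extend_iso_def aG inv)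
    ultimately have 2: "bij_betw (iso_arcs ?X) (arcs ?S) (arcs ?S)"
      using fin(2) by (simp add: bij_betw_def endo_inj_surj)
    have 3: "\<forall>a\<in>arcs ?S. tail ?S (iso_arcs ?X a) = iso_verts ?X (tail ?S a) \<and>
        head ?S (iso_arcs ?X a) = iso_verts ?X (head ?S a)"
      by (auto simp: subdiv_def extend_iso_def T'(3,4) inv)
    show "digraph_automorphism ?S ?X"
      unfolding iff using 1 2 3 by (simp add: extend_iso_def)
  qed
qed

(* The space of complex functions on the vertices, encoded as functions on the whole type that
   vanish off the vertex set; the operators below respect this convention. *)
definition vertex_functions :: "('v, 'e) pre_digraph \<Rightarrow> ('v \<Rightarrow> complex) set" where
  "vertex_functions H = {f. \<forall>v. v \<notin> verts H \<longrightarrow> f v = 0}"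

definition adjacency :: "('v, 'e) pre_digraph \<Rightarrow> 'v \<Rightarrow> 'v \<Rightarrow> nat" where
  "adjacency H u v = card {a \<in> arcs H. tail H a = u \<and> head H a = v}"

definition adjacency_op :: "('v, 'e) pre_digraph \<Rightarrow> ('v \<Rightarrow> complex) \<Rightarrow> 'v \<Rightarrow> complex" where
  "adjacency_op H f = (\<lambda>u. if u \<in> verts H then \<Sum>v\<in>verts H. of_nat (adjacency H u v) * f v else 0)"

definition pullback_op ::
  "('v, 'e) pre_digraph \<Rightarrow> ('v, 'e, 'v, 'e) digraph_isomorphism \<Rightarrow> ('v \<Rightarrow> complex) \<Rightarrow> 'v \<Rightarrow> complex" where
  "pullback_op H S f = (\<lambda>v. if v \<in> verts H then f (iso_verts S v) else 0)"

definition eigenfunction ::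
  "('v, 'e) pre_digraph \<Rightarrow> (('v \<Rightarrow> complex) \<Rightarrow> 'v \<Rightarrow> complex) \<Rightarrow> complex \<Rightarrow> ('v \<Rightarrow> complex) \<Rightarrow> bool" where
  "eigenfunction H F c f \<longleftrightarrow>
     f \<in> vertex_functions H \<and> f \<noteq> (\<lambda>_. 0) \<and> F f = (\<lambda>v. c * f v)"

definition automorphism_eigenvalue ::
  "('a, 'b) pre_digraph \<Rightarrow> ('a, 'b, 'a, 'b) digraph_isomorphism \<Rightarrow> complex \<Rightarrow> bool" where
  "automorphism_eigenvalue G T c \<longleftrightarrow>
     (\<exists>l\<in>invariant_lengths G T. \<exists>f.
        eigenfunction (subdiv G l) (pullback_op (subdiv G l) (extend_iso G T l)) c f)"

(* Z(l, c): eigenvalues of the adjacency matrix with an eigenvector that is also a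
   c-eigenvector of T. *)
definition joint_eigenvalues ::
  "('a, 'b) pre_digraph \<Rightarrow> ('a, 'b, 'a, 'b) digraph_isomorphism \<Rightarrow> ('b \<Rightarrow> nat) \<Rightarrow> complex \<Rightarrow> complex set" where
  "joint_eigenvalues G T l c =
     {z. \<exists>f. eigenfunction (subdiv G l) (adjacency_op (subdiv G l)) z f \<and>
             eigenfunction (subdiv G l) (pullback_op (subdiv G l) (extend_iso G T l)) c f}"

(* A multivariate polynomial is a finitely supported map from monomials to coefficients, a
   monomial being a finitely supported map from variables to exponents. *)
type_synonym 'x mpolynomial = "('x \<Rightarrow>\<^sub>0 nat) \<Rightarrow>\<^sub>0 complex"

definition mpoly_vars :: "'x mpolynomial \<Rightarrow> 'x set" where
  "mpoly_vars p = (\<Union>m\<in>Poly_Mapping.keys p. Poly_Mapping.keys m)"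

definition mpoly_value :: "'x mpolynomial \<Rightarrow> ('x \<Rightarrow> complex) \<Rightarrow> complex" where
  "mpoly_value p a =
     (\<Sum>m\<in>Poly_Mapping.keys p. Poly_Mapping.lookup p m *
        (\<Prod>x\<in>Poly_Mapping.keys m. a x ^ Poly_Mapping.lookup m x))"

end

theory Submission
  imports Defs "Jordan_Normal_Form.Determinant" "HOL-Combinatorics.Cycles"
begin

text \<open>
  An eigenfunction of the subdivided graph for \<open>z \<noteq> 0\<close> is determined by its restriction \<open>g\<close> to the
  original vertices, and it exists iff \<open>g = M g\<close>, where \<open>M\<close> is the adjacency matrix of \<open>G\<close> with
  every arc \<open>e\<close> weighted by \<open>X\<^sub>e = z\<^sup>-\<^sup>l\<^sup>(\<^sup>e\<^sup>)\<close>. If \<open>T\<close> has order \<open>n\<close> and \<open>c\<^sup>n = 1\<close>, let \<open>\<Pi>\<close> be the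
  projection \<open>1/n \<cdot> (\<Sum>j<n. c\<^sup>-\<^sup>j T\<^sup>j)\<close> onto the \<open>c\<close>-eigenspace of \<open>T\<close>. Since \<open>M\<close> commutes with \<open>T\<close>,
  the solutions of \<open>g = M \<Pi> g\<close> are exactly the \<open>g\<close> with \<open>g = M g\<close> and \<open>T g = c g\<close>. Hence
  \<open>det (1 - M \<Pi>)\<close> is the required polynomial in the \<open>X\<^sub>e\<close>. If \<open>c\<^sup>n \<noteq> 1\<close>, there are no such \<open>g\<close>, and the
  constant polynomial \<open>1\<close> will do.
\<close>

section \<open>Polynomial functions\<close>

definition monomial_value :: "('x \<Rightarrow>\<^sub>0 nat) \<Rightarrow> ('x \<Rightarrow> complex) \<Rightarrow> complex" where
  "monomial_value m a = (\<Prod>x\<in>Poly_Mapping.keys m. a x ^ Poly_Mapping.lookup m x)"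

text \<open>Variables outside the support contribute \<open>a x ^ 0 = 1\<close>; monomials with
  different supports can thus be compared over one common index set.\<close>

lemma monomial_value_superset:
  assumes "finite S" "Poly_Mapping.keys m \<subseteq> S"
  shows "monomial_value m a = (\<Prod>x\<in>S. a x ^ Poly_Mapping.lookup m x)"
  unfolding monomial_value_def
  by (rule prod.mono_neutral_left) (use assms in \<open>auto simp: in_keys_iff\<close>)

lemma monomial_value_add:
  "monomial_value (m + n) a = monomial_value m a * monomial_value n a"
proof -
  let ?S = "Poly_Mapping.keys m \<union> Poly_Mapping.keys n"
  have "monomial_value k a = (\<Prod>x\<in>?S. a x ^ Poly_Mapping.lookup k x)"
    if "Poly_Mapping.keys k \<subseteq> ?S" for k
    using that by (intro monomial_value_superset) auto
  then show ?thesis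
    using Poly_Mapping.keys_add[of m n]
    by (simp add: lookup_add power_add prod.distrib)
qed

lemma mpoly_value_add: "mpoly_value (p + q) a = mpoly_value p a + mpoly_value q a"
  unfolding mpoly_value_def
  by (rule Poly_Mapping.setsum_keys_plus_distrib) (auto simp: algebra_simps)

lemma mpoly_value_sum: "mpoly_value (\<Sum>i\<in>I. p i) a = (\<Sum>i\<in>I. mpoly_value (p i) a)"
  by (induction I rule: infinite_finite_induct)
    (simp_all add: mpoly_value_add, simp_all add: mpoly_value_def)

lemma mpoly_value_single: "mpoly_value (Poly_Mapping.single m c) a = c * monomial_value m a"
  by (auto simp: mpoly_value_def monomial_value_def)

lemma mpoly_value_eq_sum:
  "mpoly_value p a = (\<Sum>m\<in>Poly_Mapping.keys p. Poly_Mapping.lookup p m * monomial_value m a)"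
  by (simp add: mpoly_value_def monomial_value_def)

lemma poly_mapping_sum_singles:
  "p = (\<Sum>m\<in>Poly_Mapping.keys p. Poly_Mapping.single m (Poly_Mapping.lookup p m))"
  by (rule poly_mapping_eqI)
    (auto simp: Poly_Mapping.lookup_sum lookup_single when_def in_keys_iff)

text \<open>Both factors are expanded into single terms, for which multiplication adds exponents.
  Coinciding monomials \<open>m + n\<close> need no care, since evaluation is additive.\<close>

lemma mpoly_value_mult: "mpoly_value (p * q) a = mpoly_value p a * mpoly_value q a"
proof -
  have "p * q = (\<Sum>m\<in>Poly_Mapping.keys p. \<Sum>n\<in>Poly_Mapping.keys q.
      Poly_Mapping.single (m + n) (Poly_Mapping.lookup p m * Poly_Mapping.lookup q n))"
    \<comment> \<open>Only the leading occurrence is expanded, because \<open>p\<close> and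
      \<open>q\<close> reappear inside their own expansions.\<close>
    by (subst (1) poly_mapping_sum_singles[of p], subst (1) poly_mapping_sum_singles[of q])
      (simp add: sum_product Poly_Mapping.mult_single)
  then show ?thesis
    by (simp add: mpoly_value_sum mpoly_value_single monomial_value_add)
      (simp add: mpoly_value_eq_sum sum_product mult_ac)
qed

lemma mpoly_vars_add: "mpoly_vars (p + q) \<subseteq> mpoly_vars p \<union> mpoly_vars q"
  using Poly_Mapping.keys_add[of p q] by (auto simp: mpoly_vars_def)

lemma mpoly_vars_mult: "mpoly_vars (p * q) \<subseteq> mpoly_vars p \<union> mpoly_vars q"
proof
  fix x
  assume "x \<in> mpoly_vars (p * q)"
  then obtain k where k: "k \<in> Poly_Mapping.keys (p * q)" "x \<in> Poly_Mapping.keys k"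
    by (auto simp: mpoly_vars_def)
  then obtain m n where "k = m + n" "m \<in> Poly_Mapping.keys p" "n \<in> Poly_Mapping.keys q"
    using Poly_Mapping.keys_mult[of p q] by blast
  then show "x \<in> mpoly_vars p \<union> mpoly_vars q"
    using k(2) Poly_Mapping.keys_add[of m n] by (auto simp: mpoly_vars_def)
qed

text \<open>Polynomiality is made a property of functions of the evaluation point, so that it can be
  read off the shape of an expression by closure rules. The set \<open>A\<close> bounds the
  variables of a witness.\<close>

definition polynomial_fun :: "'x set \<Rightarrow> (('x \<Rightarrow> complex) \<Rightarrow> complex) \<Rightarrow> bool" where
  "polynomial_fun A F \<longleftrightarrow> (\<exists>P. mpoly_vars P \<subseteq> A \<and> (\<forall>a. mpoly_value P a = F a))"

lemma polynomial_fun_const: "polynomial_fun A (\<lambda>_. c)"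
  unfolding polynomial_fun_def
  by (rule exI[of _ "Poly_Mapping.single 0 c"])
    (auto simp: mpoly_value_single mpoly_vars_def monomial_value_def split: if_splits)

lemma polynomial_fun_var:
  assumes "x \<in> A"
  shows "polynomial_fun A (\<lambda>a. a x)"
  unfolding polynomial_fun_def
  by (rule exI[of _ "Poly_Mapping.single (Poly_Mapping.single x 1) 1"])
    (use assms in \<open>auto simp: mpoly_value_single mpoly_vars_def monomial_value_def\<close>)

lemma polynomial_fun_add:
  assumes "polynomial_fun A F" "polynomial_fun A H"
  shows "polynomial_fun A (\<lambda>a. F a + H a)"
proof -
  obtain p q where "mpoly_vars p \<subseteq> A" "\<forall>a. mpoly_value p a = F a"
    "mpoly_vars q \<subseteq> A" "\<forall>a. mpoly_value q a = H a"
    using assms unfolding polynomial_fun_def by blast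
  then show ?thesis
    unfolding polynomial_fun_def using mpoly_vars_add[of p q]
    by (intro exI[of _ "p + q"]) (auto simp: mpoly_value_add)
qed

lemma polynomial_fun_mult:
  assumes "polynomial_fun A F" "polynomial_fun A H"
  shows "polynomial_fun A (\<lambda>a. F a * H a)"
proof -
  obtain p q where "mpoly_vars p \<subseteq> A" "\<forall>a. mpoly_value p a = F a"
    "mpoly_vars q \<subseteq> A" "\<forall>a. mpoly_value q a = H a"
    using assms unfolding polynomial_fun_def by blast
  then show ?thesis
    unfolding polynomial_fun_def using mpoly_vars_mult[of p q]
    by (intro exI[of _ "p * q"]) (auto simp: mpoly_value_mult)
qed

lemma polynomial_fun_sum:
  assumes "\<And>i. i \<in> I \<Longrightarrow> polynomial_fun A (F i)"
  shows "polynomial_fun A (\<lambda>a. \<Sum>i\<in>I. F i a)"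
  using assms
  by (induction I rule: infinite_finite_induct) (auto intro: polynomial_fun_const polynomial_fun_add)

lemma polynomial_fun_prod:
  assumes "\<And>i. i \<in> I \<Longrightarrow> polynomial_fun A (F i)"
  shows "polynomial_fun A (\<lambda>a. \<Prod>i\<in>I. F i a)"
  using assms
  by (induction I rule: infinite_finite_induct) (auto intro: polynomial_fun_const polynomial_fun_mult)

text \<open>\<open>D\<close> is the determinant of the matrix \<open>M x\<close>: its Leibniz
  expansion is polynomial in the entries, and it vanishes iff the homogeneous system has a
  nontrivial solution.\<close>

lemma polynomial_fun_singular:
  fixes M :: "('x \<Rightarrow> complex) \<Rightarrow> 'a \<Rightarrow> 'a \<Rightarrow> complex"
  assumes fin: "finite V"
    and M: "\<And>u v. u \<in> V \<Longrightarrow> v \<in> V \<Longrightarrow> polynomial_fun A (\<lambda>x. M x u v)"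
  obtains D where "polynomial_fun A D"
    and "\<And>x. D x = 0 \<longleftrightarrow> (\<exists>g. (\<exists>v\<in>V. g v \<noteq> 0) \<and> (\<forall>u\<in>V. (\<Sum>v\<in>V. M x u v * g v) = 0))"
proof -
  obtain b where b: "bij_betw b {0..<card V} V"
    using ex_bij_betw_nat_finite[OF fin] by blast
  define n where "n = card V"
  have b: "bij_betw b {0..<n} V" using b by (simp add: n_def)
  have bV: "b i \<in> V" if "i < n" for i using b that by (auto simp: bij_betw_def)
  \<comment> \<open>The enumeration \<open>b\<close> turns the index set \<open>V\<close> into
    matrix indices; it is fixed before \<open>x\<close>, so that the expansion is uniform in
    \<open>x\<close>.\<close>
  define N where "N x = mat n n (\<lambda>(i, j). M x (b i) (b j))" for x
  have N: "N x \<in> carrier_mat n n" for x by (simp add: N_def)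
  have "det (N x) = (\<Sum>p\<in>{p. p permutes {0..<n}}. signof p * (\<Prod>i=0..<n. M x (b i) (b (p i))))" for x
    unfolding det_def'[OF N]
    by (intro sum.cong prod.cong arg_cong2[where f = "(*)"])
      (auto simp: N_def dest: permutes_in_image)
  moreover have "polynomial_fun A (\<lambda>x. \<Sum>p\<in>{p. p permutes {0..<n}}.
      signof p * (\<Prod>i=0..<n. M x (b i) (b (p i))))"
    by (intro polynomial_fun_sum polynomial_fun_mult polynomial_fun_const polynomial_fun_prod M bV)
      (auto dest: permutes_in_image)
  ultimately have 1: "polynomial_fun A (\<lambda>x. det (N x))" by simp
  have row: "(N x *\<^sub>v vec n (\<lambda>i. g (b i))) $ i = (\<Sum>v\<in>V. M x (b i) v * g v)" if "i < n" for x g i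
    using that sum.reindex_bij_betw[OF b, of "\<lambda>v. M x (b i) v * g v"]
    by (simp add: N_def scalar_prod_def)
  have 2: "det (N x) = 0 \<longleftrightarrow>
      (\<exists>g. (\<exists>v\<in>V. g v \<noteq> 0) \<and> (\<forall>u\<in>V. (\<Sum>v\<in>V. M x u v * g v) = 0))" for x
  proof
    assume "det (N x) = 0"
    then obtain w where w: "w \<in> carrier_vec n" "w \<noteq> 0\<^sub>v n" "N x *\<^sub>v w = 0\<^sub>v n"
      using det_0_iff_vec_prod_zero[OF N] by blast
    \<comment> \<open>The kernel vector is read back as a function on \<open>V\<close>; its values
      off \<open>V\<close> are arbitrary and do not matter.\<close>
    define g where "g v = w $ (inv_into {0..<n} b v)" for v
    have gb: "g (b i) = w $ i" if "i < n" for i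
      using that b by (simp add: g_def bij_betw_def)
    have wg: "w = vec n (\<lambda>i. g (b i))"
      by (rule eq_vecI) (use w(1) gb in auto)
    obtain i where i: "i < n" "w $ i \<noteq> 0" using w(1,2)
      by (metis carrier_vecD eq_vecI index_zero_vec(1) index_zero_vec(2))
    have "(\<Sum>v\<in>V. M x (b i) v * g v) = 0" if "i < n" for i
      using row[OF that, of x g] w(3) that by (simp flip: wg)
    then have "\<forall>u\<in>V. (\<Sum>v\<in>V. M x u v * g v) = 0"
      using b by (auto simp: bij_betw_def)
    moreover have "\<exists>v\<in>V. g v \<noteq> 0" using i bV gb by metis
    ultimately show "\<exists>g. (\<exists>v\<in>V. g v \<noteq> 0) \<and> (\<forall>u\<in>V. (\<Sum>v\<in>V. M x u v * g v) = 0)" by blast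
  next
    assume "\<exists>g. (\<exists>v\<in>V. g v \<noteq> 0) \<and> (\<forall>u\<in>V. (\<Sum>v\<in>V. M x u v * g v) = 0)"
    then obtain g v where g: "v \<in> V" "g v \<noteq> 0" "\<forall>u\<in>V. (\<Sum>v\<in>V. M x u v * g v) = 0" by blast
    let ?w = "vec n (\<lambda>i. g (b i))"
    obtain i where i: "i < n" "b i = v" using g(1) b by (auto simp: bij_betw_def)
    have "?w \<noteq> 0\<^sub>v n"
      using i g(2) by (metis index_vec index_zero_vec(1))
    moreover have "N x *\<^sub>v ?w = 0\<^sub>v n"
    proof (rule eq_vecI)
      fix i assume "i < dim_vec (0\<^sub>v n :: complex vec)"
      then show "(N x *\<^sub>v ?w) $ i = 0\<^sub>v n $ i" using row[of i x g] g(3) bV by simp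
    qed (simp add: N_def)
    ultimately show "det (N x) = 0"
      using det_0_iff_vec_prod_zero[OF N] vec_carrier[of n "\<lambda>i. g (b i)"] by blast
  qed
  show thesis by (rule that[OF 1 2])
qed

section \<open>Reduction to the original vertices\<close>

text \<open>Grouping the arcs leaving \<open>u\<close> by their heads turns parallel arcs into the
  entries of the adjacency matrix.\<close>

lemma adjacency_op_eq_sum_arcs:
  assumes "fin_digraph H" and u: "u \<in> verts H"
  shows "adjacency_op H f u = (\<Sum>a | a \<in> arcs H \<and> tail H a = u. f (head H a))"
proof -
  interpret fin_digraph H by fact
  let ?S = "{a \<in> arcs H. tail H a = u}"
  have "(\<Sum>a\<in>?S. f (head H a)) = (\<Sum>v\<in>verts H. \<Sum>a | a \<in> ?S \<and> head H a = v. f (head H a))"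
    by (rule sum.group[symmetric]) auto
  also have "\<dots> = (\<Sum>v\<in>verts H. of_nat (adjacency H u v) * f v)"
    by (rule sum.cong) (auto simp: adjacency_def)
  finally show ?thesis using u by (simp add: adjacency_op_def)
qed

text \<open>The arcs leaving an old vertex are the first arcs of the paths. Their heads are left
  unevaluated, since they are old vertices when \<open>l e = 1\<close> and inner vertices
  otherwise.\<close>

lemma adjacency_op_subdiv_Inl:
  assumes "fin_digraph G" "\<forall>e\<in>arcs G. 0 < l e" "u \<in> verts G"
  shows "adjacency_op (subdiv G l) f (Inl u) =
    (\<Sum>e | e \<in> arcs G \<and> tail G e = u. f (head (subdiv G l) (e, 0)))"
proof -
  have "{a \<in> arcs (subdiv G l). tail (subdiv G l) a = Inl u} =
      (\<lambda>e. (e, 0)) ` {e \<in> arcs G. tail G e = u}"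
    using assms(2) by (auto simp: subdiv_def split: if_splits)
  moreover have "Inl u \<in> verts (subdiv G l)" using assms(3) by (simp add: subdiv_def)
  ultimately show ?thesis
    by (simp add: adjacency_op_eq_sum_arcs fin_digraph_subdiv assms sum.reindex inj_on_def)
qed

lemma adjacency_op_subdiv_Inr:
  assumes "fin_digraph G" "\<forall>e\<in>arcs G. 0 < l e" "e \<in> arcs G" "0 < i" "i < l e"
  shows "adjacency_op (subdiv G l) f (Inr (e, i)) = f (head (subdiv G l) (e, i))"
proof -
  have "{a \<in> arcs (subdiv G l). tail (subdiv G l) a = Inr (e, i)} = {(e, i)}"
    using assms(3-5) by (auto simp: subdiv_def split: if_splits)
  moreover have "Inr (e, i) \<in> verts (subdiv G l)" using assms(3-5) by (simp add: subdiv_def)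
  ultimately show ?thesis
    by (simp add: adjacency_op_eq_sum_arcs fin_digraph_subdiv assms)
qed

text \<open>The adjacency operator of \<open>G\<close> with arc weights \<open>x\<close>, called
  \<open>M\<close> in the overview when \<open>x e = inverse z ^ l e\<close>.\<close>

definition transfer_op ::
  "('a, 'b) pre_digraph \<Rightarrow> ('b \<Rightarrow> complex) \<Rightarrow> ('a \<Rightarrow> complex) \<Rightarrow> 'a \<Rightarrow> complex" where
  "transfer_op G x g u = (\<Sum>e | e \<in> arcs G \<and> tail G e = u. x e * g (head G e))"

text \<open>An inner vertex has a single outgoing arc, so the eigenvalue equation makes its value
  \<open>inverse z\<close> times the next value on the path. Traversing all of \<open>e\<close>
  therefore contributes \<open>inverse z ^ l e\<close>, and inner values are determined by old
  ones.\<close>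

lemma joint_eigenvalues_iff_transfer:
  assumes G: "fin_digraph G" and T: "digraph_automorphism G T"
    and l: "l \<in> invariant_lengths G T" and z: "z \<noteq> 0"
  shows "z \<in> joint_eigenvalues G T l c \<longleftrightarrow>
    (\<exists>g. (\<exists>v\<in>verts G. g v \<noteq> 0) \<and>
         (\<forall>u\<in>verts G. transfer_op G (\<lambda>e. inverse z ^ l e) g u = g u) \<and>
         (\<forall>u\<in>verts G. g (iso_verts T u) = c * g u))"
    (is "_ \<longleftrightarrow> (\<exists>g. ?P g)")
proof
  let ?S = "subdiv G l" and ?X = "extend_iso G T l"
  interpret fin_digraph G by fact
  have pos: "\<forall>e\<in>arcs G. 0 < l e" and inv: "\<And>e. e \<in> arcs G \<Longrightarrow> l (iso_arcs T e) = l e"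
    using l by (auto simp: invariant_lengths_def)
  note adj = adjacency_op_subdiv_Inl[OF G pos] adjacency_op_subdiv_Inr[OF G pos]
  have vS: "Inl u \<in> verts ?S \<longleftrightarrow> u \<in> verts G"
    "Inr (e, i) \<in> verts ?S \<longleftrightarrow> e \<in> arcs G \<and> 0 < i \<and> i < l e" for u e i
    by (auto simp: subdiv_def)
  {
    assume "z \<in> joint_eigenvalues G T l c"
    then obtain f where f: "f \<in> vertex_functions ?S" "f \<noteq> (\<lambda>_. 0)"
      "adjacency_op ?S f = (\<lambda>v. z * f v)" "pullback_op ?S ?X f = (\<lambda>v. c * f v)"
      unfolding joint_eigenvalues_def eigenfunction_def by blast
    have inner: "f (Inr (e, i)) = inverse z * f (head ?S (e, i))"
      if "e \<in> arcs G" "0 < i" "i < l e" for e i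
      using adj(2)[OF that, of f] z by (simp add: f(3) field_simps)
    \<comment> \<open>Induction runs backwards from the end of the path: \<open>k = 0\<close> is the
      last arc, whose head is the old vertex \<open>head G e\<close>.\<close>
    have path: "f (head ?S (e, l e - Suc k)) = inverse z ^ k * f (Inl (head G e))"
      if "e \<in> arcs G" "k < l e" for e k
      using that(2)
    proof (induction k)
      case 0
      then show ?case by (simp add: subdiv_def)
    next
      case (Suc k)
      have "head ?S (e, l e - Suc (Suc k)) = Inr (e, l e - Suc k)"
        using Suc.prems by (auto simp: subdiv_def)
      then show ?case
        using inner[of e "l e - Suc k"] Suc that(1) by simp
    qed
    define g where "g u = f (Inl u)" for u
    \<comment> \<open>Here \<open>k = l e - 1\<close>; the factor \<open>z\<close> makes up for the
      missing power, and cancels against the eigenvalue below.\<close>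
    have first: "f (head ?S (e, 0)) = z * (inverse z ^ l e * g (head G e))" if e: "e \<in> arcs G" for e
    proof -
      obtain k where k: "l e = Suc k" using gr0_implies_Suc pos e by blast
      show ?thesis using path[OF e, of k] z by (simp add: k g_def)
    qed
    have "transfer_op G (\<lambda>e. inverse z ^ l e) g u = g u" if "u \<in> verts G" for u
    proof -
      have "z * g u = z * transfer_op G (\<lambda>e. inverse z ^ l e) g u"
        using adj(1)[OF that, of f]
        by (simp add: f(3) first transfer_op_def sum_distrib_left g_def)
      then show ?thesis using z by simp
    qed
    moreover have "g (iso_verts T u) = c * g u" if "u \<in> verts G" for u
      using fun_cong[OF f(4), of "Inl u"] that
      by (simp add: pullback_op_def vS g_def extend_iso_def)
    \<comment> \<open>If \<open>g\<close> vanished on the old vertices, then \<open>inner\<close>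
      and \<open>path\<close> would make \<open>f\<close> vanish on the inner ones too.\<close>
    moreover have "\<exists>v\<in>verts G. g v \<noteq> 0"
    proof (rule ccontr)
      assume "\<not> ?thesis"
      then have g0: "\<And>v. v \<in> verts G \<Longrightarrow> f (Inl v) = 0" by (auto simp: g_def)
      have "f v = 0" for v
      proof (cases v)
        case (Inl u)
        then show ?thesis using g0 f(1) vS(1)[of u] by (auto simp: vertex_functions_def)
      next
        case (Inr p)
        obtain e i where p: "p = (e, i)" by force
        show ?thesis
        proof (cases "e \<in> arcs G \<and> 0 < i \<and> i < l e")
          case True
          then show ?thesis
            using inner[of e i] path[of e "l e - Suc i"] g0[of "head G e"] by (simp add: Inr p)
        next
          case False
          then show ?thesis
            using f(1) vS(2)[of e i] Inr p by (auto simp: vertex_functions_def)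
        qed
      qed
      then show False using f(2) by auto
    qed
    ultimately show "\<exists>g. ?P g" by blast
  next
    assume "\<exists>g. ?P g"
    then obtain g where g0: "\<exists>v\<in>verts G. g v \<noteq> 0"
      and gM: "\<And>u. u \<in> verts G \<Longrightarrow> transfer_op G (\<lambda>e. inverse z ^ l e) g u = g u"
      and gT: "\<And>u. u \<in> verts G \<Longrightarrow> g (iso_verts T u) = c * g u" by blast
    have T': "bij_betw (iso_verts T) (verts G) (verts G)" "bij_betw (iso_arcs T) (arcs G) (arcs G)"
      "\<And>e. e \<in> arcs G \<Longrightarrow> head G (iso_arcs T e) = iso_verts T (head G e)"
      using T unfolding digraph_automorphism_iff[OF G] by blast+
    have vT: "\<And>v. v \<in> verts G \<Longrightarrow> iso_verts T v \<in> verts G"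
      and aT: "\<And>e. e \<in> arcs G \<Longrightarrow> iso_arcs T e \<in> arcs G"
      using T'(1,2) by (auto simp: bij_betw_def)
    \<comment> \<open>The only possible extension of \<open>g\<close>: the inner vertex
      \<open>(e, i)\<close> lies \<open>l e - i\<close> steps before the head of
      \<open>e\<close>.\<close>
    define f where "f v = (if v \<in> verts ?S then
        (case v of Inl u \<Rightarrow> g u | Inr (e, i) \<Rightarrow> inverse z ^ (l e - i) * g (head G e)) else 0)" for v
    have fhead: "f (head ?S (e, i)) = inverse z ^ (l e - Suc i) * g (head G e)"
      if "e \<in> arcs G" "i < l e" for e i
    proof (cases "Suc i = l e")
      case True
      then have "head ?S (e, i) = Inl (head G e)" by (simp add: subdiv_def)
      then show ?thesis using True that(1) by (simp add: f_def vS)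
    next
      case False
      then have "head ?S (e, i) = Inr (e, Suc i)" by (simp add: subdiv_def)
      then show ?thesis using False that by (simp add: f_def vS)
    qed
    have "adjacency_op ?S f v = z * f v" for v
    proof (cases "v \<in> verts ?S")
      case True
      show ?thesis
      proof (cases v)
        case (Inl u)
        then have u: "u \<in> verts G" using True vS by simp
        have "f (head ?S (e, 0)) = z * (inverse z ^ l e * g (head G e))" if e: "e \<in> arcs G" for e
        proof -
          obtain k where k: "l e = Suc k" using gr0_implies_Suc pos e by blast
          show ?thesis using fhead[OF e, of 0] z by (simp add: k)
        qed
        then show ?thesis
          using Inl adj(1)[OF u, of f] gM[OF u]
          by (simp add: f_def vS u transfer_op_def flip: sum_distrib_left)
      next
        case (Inr p)
        obtain e i where p: "p = (e, i)" by force
        then have ei: "e \<in> arcs G" "0 < i" "i < l e" using True vS Inr by auto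
        obtain k where k: "l e = Suc (i + k)" using ei(3) less_iff_Suc_add by auto
        have "f v = inverse z ^ Suc k * g (head G e)"
          using ei Inr p by (simp add: f_def vS) (simp add: k Suc_diff_le)
        moreover have "adjacency_op ?S f v = inverse z ^ k * g (head G e)"
          using adj(2)[OF ei, of f] fhead[OF ei(1,3)] by (simp add: Inr p k)
        ultimately show ?thesis using z by simp
      qed
    next
      case False
      then show ?thesis by (simp add: adjacency_op_def f_def)
    qed
    moreover have "pullback_op ?S ?X f v = c * f v" for v
      by (auto simp: pullback_op_def f_def vS extend_iso_def vT aT inv gT T'(3) split: sum.splits)
    moreover have "f \<in> vertex_functions ?S" by (simp add: vertex_functions_def f_def)
    moreover obtain v where "v \<in> verts G" "g v \<noteq> 0" using g0 by blast
    then have "f (Inl v) \<noteq> 0" by (simp add: f_def vS)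
    then have "f \<noteq> (\<lambda>_. 0)" by metis
    ultimately show "z \<in> joint_eigenvalues G T l c"
      unfolding joint_eigenvalues_def eigenfunction_def by blast
  }
qed

section \<open>Averaging over the cyclic group generated by a permutation\<close>

text \<open>For \<open>t ^^ n = id\<close> and \<open>c ^ n = 1\<close> this is the projection onto
  the \<open>c\<close>-eigenspace of pullback along \<open>t\<close>.\<close>

definition averaging :: "('a \<Rightarrow> 'a) \<Rightarrow> nat \<Rightarrow> complex \<Rightarrow> ('a \<Rightarrow> complex) \<Rightarrow> 'a \<Rightarrow> complex" where
  "averaging t n c g v = (\<Sum>j<n. inverse c ^ j * g ((t ^^ j) v)) / of_nat n"

text \<open>Replacing \<open>v\<close> by \<open>t v\<close> shifts the summation index by one at
  the cost of a factor \<open>c\<close>; the terms for \<open>0\<close> and \<open>n\<close> agree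
  by the two periodicity assumptions.\<close>

lemma averaging_equivariant:
  assumes "0 < n" "c ^ n = 1" "t ^^ n = id"
  shows "averaging t n c g (t v) = c * averaging t n c g v"
proof -
  have c: "c \<noteq> 0" using assms(1,2) by (auto simp: power_0_left)
  let ?h = "\<lambda>j. inverse c ^ j * g ((t ^^ j) v)"
  have "(\<Sum>j<n. inverse c ^ j * g ((t ^^ j) (t v))) = (\<Sum>j<n. c * ?h (Suc j))"
    by (intro sum.cong refl) (use c in \<open>simp add: funpow_swap1\<close>)
  also have "\<dots> = c * ((\<Sum>j<Suc n. ?h j) - ?h 0)"
    by (subst sum.lessThan_Suc_shift) (simp add: sum_distrib_left)
  also have "\<dots> = c * (\<Sum>j<n. ?h j)"
    using assms(2,3) by (simp add: power_inverse)
  finally show ?thesis by (simp add: averaging_def)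
qed

lemma funpow_eigenfunction:
  assumes "\<And>v. v \<in> V \<Longrightarrow> t v \<in> V" "\<And>v. v \<in> V \<Longrightarrow> g (t v) = c * g v" "v \<in> V"
  shows "(t ^^ j) v \<in> V \<and> g ((t ^^ j) v) = c ^ j * (g v :: complex)"
  by (induction j) (use assms in auto)

lemma averaging_eigenfunction:
  assumes "0 < n" "c ^ n = 1" "\<And>v. v \<in> V \<Longrightarrow> t v \<in> V" "\<And>v. v \<in> V \<Longrightarrow> g (t v) = c * g v" "v \<in> V"
  shows "averaging t n c g v = g v"
proof -
  have c: "c \<noteq> 0" using assms(1,2) by (auto simp: power_0_left)
  have "inverse c ^ j * g ((t ^^ j) v) = g v" for j
  proof -
    have "g ((t ^^ j) v) = c ^ j * g v"
      using funpow_eigenfunction[of V t g c v j] assms(3-5) by blast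
    then show ?thesis using c by (simp add: field_simps)
  qed
  then show ?thesis using assms(1) by (simp add: averaging_def)
qed

text \<open>Gives the matrix of the averaging operator, whose column \<open>v\<close> is the average
  of the indicator function of \<open>v\<close>; entries are needed to form a determinant.\<close>

lemma averaging_kernel:
  assumes "finite V" "\<And>v. v \<in> V \<Longrightarrow> t v \<in> V" "w \<in> V"
  shows "averaging t n c g w = (\<Sum>v\<in>V. averaging t n c (\<lambda>x. of_bool (x = v)) w * g v)"
proof -
  have tj: "(t ^^ j) w \<in> V" for j
    by (induction j) (use assms in auto)
  have "(\<Sum>v\<in>V. averaging t n c (\<lambda>x. of_bool (x = v)) w * g v) =
      (\<Sum>j<n. \<Sum>v\<in>V. inverse c ^ j * of_bool ((t ^^ j) w = v) * g v) / of_nat n"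
    unfolding averaging_def sum_distrib_right sum_divide_distrib
    by (subst sum.swap) (simp only: times_divide_eq_left)
  also have "\<dots> = averaging t n c g w"
    using assms(1) tj by (simp add: averaging_def of_bool_def if_distrib if_distribR cong: if_cong)
  finally show ?thesis by simp
qed

text \<open>The automorphism maps the arcs leaving \<open>u\<close> bijectively onto those leaving
  its image, preserving the weights; so the transfer operator commutes with pullback.\<close>

lemma transfer_op_equivariant:
  assumes G: "fin_digraph G" and T: "digraph_automorphism G T"
    and x: "\<And>e. e \<in> arcs G \<Longrightarrow> x (iso_arcs T e) = x e" and u: "u \<in> verts G"
  shows "transfer_op G x g (iso_verts T u) = transfer_op G x (\<lambda>v. g (iso_verts T v)) u"
proof -
  interpret fin_digraph G by fact
  have T': "bij_betw (iso_verts T) (verts G) (verts G)" "bij_betw (iso_arcs T) (arcs G) (arcs G)"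
    "\<And>e. e \<in> arcs G \<Longrightarrow> tail G (iso_arcs T e) = iso_verts T (tail G e)"
    "\<And>e. e \<in> arcs G \<Longrightarrow> head G (iso_arcs T e) = iso_verts T (head G e)"
    using T unfolding digraph_automorphism_iff[OF G] by blast+
  have tail: "tail G (iso_arcs T e) = iso_verts T u \<longleftrightarrow> tail G e = u" if "e \<in> arcs G" for e
    using T'(1) T'(3)[OF that] u that tail_in_verts by (auto simp: bij_betw_def dest: inj_onD)
  have "bij_betw (iso_arcs T) {e \<in> arcs G. tail G e = u} {e \<in> arcs G. tail G e = iso_verts T u}"
    unfolding bij_betw_def
  proof
    show "inj_on (iso_arcs T) {e \<in> arcs G. tail G e = u}"
      using T'(2) by (auto simp: bij_betw_def intro: inj_on_subset)
    show "iso_arcs T ` {e \<in> arcs G. tail G e = u} = {e \<in> arcs G. tail G e = iso_verts T u}"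
      using T'(2) tail by (auto simp: bij_betw_def image_iff) (metis imageE)
  qed
  from sum.reindex_bij_betw[OF this, of "\<lambda>e. x e * g (head G e)"] show ?thesis
    by (simp add: transfer_op_def x T'(4))
qed

theorem proposition2p8:
  fixes G :: "('a, 'b) pre_digraph"
    and T :: "('a, 'b, 'a, 'b) digraph_isomorphism"
    and lam0 :: complex
  assumes "fin_digraph G"
    and "digraph_automorphism G T"
    and "automorphism_eigenvalue G T lam0"
  shows "\<exists>P :: 'b mpolynomial. mpoly_vars P \<subseteq> arcs G \<and>
    (\<forall>l\<in>invariant_lengths G T. \<forall>z::complex. z \<noteq> 0 \<longrightarrow>
       (mpoly_value P (\<lambda>e. inverse z ^ l e) = 0 \<longleftrightarrow> z \<in> joint_eigenvalues G T l lam0))"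
proof -
  interpret fin_digraph G by fact
  note G = assms(1) and T = assms(2)
  let ?V = "verts G"
  have bij: "bij_betw (iso_verts T) ?V ?V"
    using T unfolding digraph_automorphism_iff[OF G] by blast
  \<comment> \<open>The vertex map is unconstrained off \<open>verts G\<close>; extending it by the
    identity gives a permutation of the whole type, some positive power of which is
    \<open>id\<close>.\<close>
  define t where "t v = (if v \<in> ?V then iso_verts T v else v)" for v
  have tT: "t v = iso_verts T v" if "v \<in> ?V" for v using that by (simp add: t_def)
  have "bij_betw t ?V ?V" using bij tT by (simp cong: bij_betw_cong)
  then have "t permutes ?V" by (rule bij_imp_permutes) (simp add: t_def)
  then have "permutation t" and tV: "\<And>v. v \<in> ?V \<Longrightarrow> t v \<in> ?V"
    using permutes_imp_permutation[OF finite_verts] by (auto simp: permutes_in_image)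
  then obtain n where n: "t ^^ n = id" "0 < n" using permutation_is_nilpotent by blast
  have iff: "z \<in> joint_eigenvalues G T l lam0 \<longleftrightarrow>
      (\<exists>g. (\<exists>v\<in>?V. g v \<noteq> 0) \<and> (\<forall>u\<in>?V. transfer_op G (\<lambda>e. inverse z ^ l e) g u = g u) \<and>
           (\<forall>u\<in>?V. g (t u) = lam0 * g u))"
    if "l \<in> invariant_lengths G T" "z \<noteq> 0" for l z
    by (simp add: joint_eigenvalues_iff_transfer[OF G T that] tT)
  have "\<exists>D. polynomial_fun (arcs G) D \<and> (\<forall>l\<in>invariant_lengths G T. \<forall>z. z \<noteq> 0 \<longrightarrow>
      (D (\<lambda>e. inverse z ^ l e) = 0 \<longleftrightarrow> z \<in> joint_eigenvalues G T l lam0))"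
  proof (cases "lam0 ^ n = 1")
    case False
    \<comment> \<open>Applying the eigenvalue equation \<open>n\<close> times yields
      \<open>g v = lam0 ^ n * g v\<close>.\<close>
    have "g v = 0" if g: "\<forall>u\<in>?V. g (t u) = lam0 * g u" and v: "v \<in> ?V"
      for g :: "'a \<Rightarrow> complex" and v
    proof -
      have "g ((t ^^ n) v) = lam0 ^ n * g v"
        using funpow_eigenfunction[where V = ?V and t = t and g = g and c = lam0] tV g v by blast
      then show ?thesis using False by (simp add: n)
    qed
    then have "z \<notin> joint_eigenvalues G T l lam0"
      if "l \<in> invariant_lengths G T" "z \<noteq> 0" for l z
      unfolding iff[OF that] by blast
    then show ?thesis
      by (intro exI[of _ "\<lambda>_. 1"] conjI polynomial_fun_const) simp
  next
    case True
    let ?A = "averaging t n lam0"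
    \<comment> \<open>The matrix of the identity minus transfer after averaging. Subtraction is
      written as adding a multiple by \<open>-1\<close> to fit the closure rules for polynomial
      functions.\<close>
    define M :: "('b \<Rightarrow> complex) \<Rightarrow> 'a \<Rightarrow> 'a \<Rightarrow> complex" where "M x u v = of_bool (u = v) +
        (-1) * (\<Sum>e | e \<in> arcs G \<and> tail G e = u. x e * ?A (\<lambda>y. of_bool (y = v)) (head G e))"
      for x u v
    have M: "(\<Sum>v\<in>?V. M x u v * g v) = g u - transfer_op G x (?A g) u" if "u \<in> ?V" for x u g
    proof -
      have K: "?A g w = (\<Sum>v\<in>?V. ?A (\<lambda>y. of_bool (y = v)) w * g v)" if "w \<in> ?V" for w
        by (rule averaging_kernel[OF finite_verts tV that])
      have "transfer_op G x (?A g) u = (\<Sum>e | e \<in> arcs G \<and> tail G e = u.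
          x e * (\<Sum>v\<in>?V. ?A (\<lambda>y. of_bool (y = v)) (head G e) * g v))"
        unfolding transfer_op_def by (intro sum.cong refl) (simp add: K)
      also have "\<dots> = (\<Sum>v\<in>?V. (\<Sum>e | e \<in> arcs G \<and> tail G e = u.
          x e * ?A (\<lambda>y. of_bool (y = v)) (head G e)) * g v)"
        by (simp add: sum_distrib_left sum_distrib_right mult.assoc) (rule sum.swap)
      finally have "transfer_op G x (?A g) u = \<dots>" .
      moreover have "(\<Sum>v\<in>?V. of_bool (u = v) * g v) = g u"
        using that by (simp add: of_bool_def if_distrib[of "\<lambda>b. b * _"] cong: if_cong)
      ultimately show ?thesis
        by (simp add: M_def distrib_right left_diff_distrib sum.distrib sum_subtractf)
    qed
    have "polynomial_fun (arcs G) (\<lambda>x. M x u v)" for u v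
      unfolding M_def
      by (intro polynomial_fun_add polynomial_fun_mult polynomial_fun_sum polynomial_fun_const
          polynomial_fun_var) auto
    from polynomial_fun_singular[of ?V "arcs G" M, OF _ this]
    obtain D where D: "polynomial_fun (arcs G) D" and
      D0: "\<And>x. D x = 0 \<longleftrightarrow> (\<exists>g. (\<exists>v\<in>?V. g v \<noteq> 0) \<and> (\<forall>u\<in>?V. (\<Sum>v\<in>?V. M x u v * g v) = 0))"
      by auto
    have "(\<forall>u\<in>?V. (\<Sum>v\<in>?V. M x u v * g v) = 0) \<longleftrightarrow>
        (\<forall>u\<in>?V. transfer_op G x g u = g u) \<and> (\<forall>u\<in>?V. g (t u) = lam0 * g u)" (is "?L \<longleftrightarrow> ?R")
      if x: "\<And>e. e \<in> arcs G \<Longrightarrow> x (iso_arcs T e) = x e" for x g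
    proof -
      have fixed: "transfer_op G x (?A g) u = transfer_op G x g u"
        if "\<forall>u\<in>?V. g (t u) = lam0 * g u" for u
        unfolding transfer_op_def
        by (intro sum.cong refl arg_cong2[where f = "(*)"] averaging_eigenfunction[where V = ?V])
          (use n True tV that in auto)
      have L: "?L \<longleftrightarrow> (\<forall>u\<in>?V. g u = transfer_op G x (?A g) u)" by (simp add: M)
      show ?thesis
      proof
        assume ?L
        then have g: "\<And>u. u \<in> ?V \<Longrightarrow> g u = transfer_op G x (?A g) u" using L by blast
        \<comment> \<open>A solution is the transfer of an averaged function. Averages are
          \<open>lam0\<close>-eigenfunctions, and transfer commutes with \<open>t\<close>, so
          \<open>g\<close> is one as well.\<close>
        have "g (t u) = lam0 * g u" if u: "u \<in> ?V" for u
        proof -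
          have "g (t u) = transfer_op G x (\<lambda>v. ?A g (iso_verts T v)) u"
            using g[OF tV[OF u]] transfer_op_equivariant[OF G T, of x u "?A g"] x u by (simp add: tT)
          also have "\<dots> = transfer_op G x (\<lambda>v. ?A g (t v)) u"
            by (auto simp: transfer_op_def tT intro!: sum.cong)
          also have "\<dots> = lam0 * transfer_op G x (?A g) u"
            by (simp add: averaging_equivariant[OF n(2) True n(1)] transfer_op_def
                sum_distrib_left mult_ac)
          finally show ?thesis using g[OF u] by simp
        qed
        then show ?R using g fixed by simp
      next
        assume ?R
        then show ?L using L fixed by simp
      qed
    qed
    \<comment> \<open>The weights \<open>inverse z ^ l e\<close> are invariant under the arc map
      because \<open>l\<close> is.\<close>
    then have "D (\<lambda>e. inverse z ^ l e) = 0 \<longleftrightarrow> z \<in> joint_eigenvalues G T l lam0"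
      if "l \<in> invariant_lengths G T" "z \<noteq> 0" for l z
      unfolding D0 iff[OF that] using that(1) by (simp add: invariant_lengths_def)
    with D show ?thesis by blast
  qed
  then show ?thesis unfolding polynomial_fun_def by metis
qed

end
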